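(* Let $n\ge 1$ and $0\le k\le n$. Let $B_0$ be the delta function basis of $\mathcal F$ and let $B_n$ be a Gelfand-Tsetlin basis of $\mathcal F$. Assume that the matrices $[B_{i-1}]_{B_i}$ for $i=2,3,\dots,n$ have been computed, where $B_1,\dots,B_{n-1}$ are the intermediate bases. Then, given a column vector $[f]_{B_0}$ with $f\in\mathcal F$, the column vector $[f]_{B_n}$ given by $$[f]_{B_n}=[B_0]_{B_n}\,[f]_{B_0}$$ can be computed using at most $2(n-1)\binom nk$ operations.
   Context: Let $X$ be the set of words $w_1\dots w_n$ in the alphabet $\{1,2\}$ with exactly $k$ letters $1$ (the word corresponds to the $k$-subset $\{j: w_j=1\}$ of $\{1,\dots,n\}$). The symmetric group $S_n$ acts on $X$ via its action on $k$-subsets. $\mathcal F$ is the space of complex functions on $X$, with $\sigma f=f\circ\sigma^{-1}$ and the inner product for which the delta functions $\delta(x)$, $x\in X$, are orthonormal. For $i\le n$, $S_i\subset S_n$ is the subgroup fixing $i+1,\dots,n$; irreducible representations of $S_i$ are indexed by Young diagrams with $i$ boxes in the usual way ($(i)$ is the trivial representation), and $\mathcal F_{i,\lambda}$ is the $\lambda$-isotypic component of $\mathcal F$ as an $S_i$-module. Write $\lambda\nearrow\mu$ if $\mu$ is obtained from $\lambda$ by adding one box. For Young diagrams $\lambda_1,\dots,\lambda_p$ with $\lambda_j$ having $j$ boxes, $\mathcal F_{\lambda_1\dots\lambda_p}=\mathcal F_{1,\lambda_1}\cap\dots\cap\mathcal F_{p,\lambda_p}$. For a word $c_q\dots c_n$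 in $\{1,2\}$, $\mathcal F^{c_q\dots c_n}$ is the span of the $\delta(w)$ with $w\in X$, $w_q\dots w_n=c_q\dots c_n$; for $q=n+1$ (empty word) it is $\mathcal F$. Put $\mathcal F_{\lambda_1\dots\lambda_p}^{c_q\dots c_n}=\mathcal F_{\lambda_1\dots\lambda_p}\cap\mathcal F^{c_q\dots c_n}$ (for $p=0$ this means $\mathcal F^{c_q\dots c_n}$). For $0\le i\le n$, $\mathcal F$ is the orthogonal direct sum of the one-dimensional subspaces $\mathcal F_{\lambda_1\dots\lambda_i}^{c_{i+1}\dots c_n}$, over all words $c_{i+1}\dots c_n$ with exactly $k-r$ letters $1$ for some $0\le r\le k$, and all chains $\lambda_1\nearrow\dots\nearrow\lambda_i$ with $\lambda_i=(i-a,a)$, $0\le a\le\min(r,i-r)$. The $i$-th intermediate basis $B_i$ is obtained by choosing one unit vector in each of these subspaces (it is unique up to scalars). For $i=n$ this is a Gelfand-Tsetlin basis; for $i=0$ the unit vectors are taken to be the delta functions, and $B_1$ is normalized so that $B_1=B_0$. $[B]_{B'}$ denotes the change of basis matrix, whose columns are the elements of $B$ written in the basis $B'$, and $[f]_B$ is the coordinate column vector of $f$ in $B$. Computational model: a single complex multiplication and addition counts as one operation. Only these algebraic operations are counted; operations involved in storage (for example reordering rows and columns of a matrix) are not counted. *)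

theory Defs
  imports
    Complex_Main
    "HOL-Library.Function_Algebras"
    "HOL-Library.FuncSet"
    "HOL-Combinatorics.Permutations"
begin

section \<open>Complex-valued functions as a vector space\<close>

definition cscale :: "complex \<Rightarrow> ('a \<Rightarrow> complex) \<Rightarrow> 'a \<Rightarrow> complex" where
  "cscale c f = (\<lambda>x. c * f x)"

global_interpretation cfun: vector_space "cscale :: complex \<Rightarrow> ('a \<Rightarrow> complex) \<Rightarrow> 'a \<Rightarrow> complex"
  by unfold_locales (auto simp: cscale_def fun_eq_iff algebra_simps)

definition delta :: "'a \<Rightarrow> 'a \<Rightarrow> complex" where
  "delta x = (\<lambda>y. if y = x then 1 else 0)"


section \<open>Young diagrams\<close>

type_synonym diagram = "(nat \<times> nat) set"

text \<open>A diagram is its set of boxes (row, column), both counted from 0.\<close>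

definition young_diagram :: "diagram \<Rightarrow> bool" where
  "young_diagram D \<longleftrightarrow>
     finite D \<and> (\<forall>r c r' c'. (r, c) \<in> D \<and> r' \<le> r \<and> c' \<le> c \<longrightarrow> (r', c') \<in> D)"

definition adds_box :: "diagram \<Rightarrow> diagram \<Rightarrow> bool" where
  "adds_box D E \<longleftrightarrow> (\<exists>b. b \<notin> D \<and> E = insert b D)"

definition two_row :: "nat \<Rightarrow> nat \<Rightarrow> diagram" where
  "two_row p q = {0} \<times> {..<p} \<union> {1} \<times> {..<q}"

text \<open>The list \<open>[D\<^sub>1, \<dots>, D\<^sub>p]\<close> has \<open>D\<^sub>j\<close> at list index \<open>j - 1\<close>.\<close>

definition diagram_chain :: "diagram list \<Rightarrow> bool" where
  "diagram_chain ch \<longleftrightarrow>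
     (\<forall>j < length ch. young_diagram (ch ! j) \<and> card (ch ! j) = Suc j) \<and>
     (\<forall>j. Suc j < length ch \<longrightarrow> adds_box (ch ! j) (ch ! Suc j))"


section \<open>Specht modules\<close>

text \<open>
  The symmetric group on \<open>i\<close> letters is \<open>{\<sigma>. \<sigma> permutes {..<i}}\<close>; letters are counted from 0.
  A tableau maps each letter to its box.  A tabloid, i.e. a row-equivalence class of tableaux,
  is represented by the function that maps each letter to its row.
\<close>

type_synonym tabloid = "nat \<Rightarrow> nat"

definition tableau :: "nat \<Rightarrow> diagram \<Rightarrow> (nat \<Rightarrow> nat \<times> nat) \<Rightarrow> bool" where
  "tableau i D t \<longleftrightarrow> bij_betw t {..<i} D"

definition tabloid :: "nat \<Rightarrow> (nat \<Rightarrow> nat \<times> nat) \<Rightarrow> tabloid" where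
  "tabloid i t = restrict (\<lambda>m. fst (t m)) {..<i}"

definition column_stabilizer :: "nat \<Rightarrow> (nat \<Rightarrow> nat \<times> nat) \<Rightarrow> (nat \<Rightarrow> nat) set" where
  "column_stabilizer i t = {\<pi>. \<pi> permutes {..<i} \<and> (\<forall>m<i. snd (t (\<pi> m)) = snd (t m))}"

text \<open>\<open>\<pi>\<close> acts on tableaux by \<open>t \<mapsto> t \<circ> \<pi>\<^sup>-\<^sup>1\<close>, that is, by applying \<open>\<pi>\<close> to the entries.\<close>

definition polytabloid :: "nat \<Rightarrow> (nat \<Rightarrow> nat \<times> nat) \<Rightarrow> tabloid \<Rightarrow> complex" where
  "polytabloid i t =
     (\<Sum>\<pi>\<in>column_stabilizer i t. cscale (of_int (sign \<pi>)) (delta (tabloid i (t \<circ> inv \<pi>))))"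

definition specht :: "nat \<Rightarrow> diagram \<Rightarrow> (tabloid \<Rightarrow> complex) set" where
  "specht i D = cfun.span {polytabloid i t | t. tableau i D t}"

text \<open>
  \<open>(\<sigma> v)(T) = v (\<sigma>\<^sup>-\<^sup>1 T)\<close>, where \<open>\<sigma>\<^sup>-\<^sup>1 T = T \<circ> \<sigma>\<close>.
\<close>

definition tabloid_act :: "(nat \<Rightarrow> nat) \<Rightarrow> (tabloid \<Rightarrow> complex) \<Rightarrow> tabloid \<Rightarrow> complex" where
  "tabloid_act \<sigma> v = (\<lambda>T. v (T \<circ> \<sigma>))"


section \<open>Functions on words\<close>

type_synonym word = "nat list"

definition words :: "nat \<Rightarrow> nat \<Rightarrow> word set" where
  "words n k = {w. length w = n \<and> set w \<subseteq> {1, 2} \<and> count_list w 1 = k}"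

definition word_funs :: "nat \<Rightarrow> nat \<Rightarrow> (word \<Rightarrow> complex) set" where
  "word_funs n k = {f. \<forall>w. w \<notin> words n k \<longrightarrow> f w = 0}"

definition word_inner :: "nat \<Rightarrow> nat \<Rightarrow> (word \<Rightarrow> complex) \<Rightarrow> (word \<Rightarrow> complex) \<Rightarrow> complex" where
  "word_inner n k f g = (\<Sum>w\<in>words n k. f w * cnj (g w))"

text \<open>
  Acting on the subset of positions that carry the letter 1, \<open>\<sigma>\<close> sends \<open>w\<close> to the word with letter
  \<open>w ! (inv \<sigma> j)\<close> at position \<open>j\<close>.  Hence \<open>permute_list \<sigma> w\<close> is the image of \<open>w\<close> under
  \<open>inv \<sigma>\<close>, and \<open>word_act \<sigma> f\<close> is \<open>f\<close> composed with the action of \<open>inv \<sigma>\<close>.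
\<close>

definition word_act :: "(nat \<Rightarrow> nat) \<Rightarrow> (word \<Rightarrow> complex) \<Rightarrow> word \<Rightarrow> complex" where
  "word_act \<sigma> f = (\<lambda>w. f (permute_list \<sigma> w))"

definition word_submodule :: "nat \<Rightarrow> nat \<Rightarrow> nat \<Rightarrow> (word \<Rightarrow> complex) set \<Rightarrow> bool" where
  "word_submodule n k i U \<longleftrightarrow>
     cfun.subspace U \<and> U \<subseteq> word_funs n k \<and>
     (\<forall>\<sigma>. \<sigma> permutes {..<i} \<longrightarrow> (\<forall>f\<in>U. word_act \<sigma> f \<in> U))"

definition specht_iso :: "nat \<Rightarrow> diagram \<Rightarrow> (word \<Rightarrow> complex) set \<Rightarrow> bool" where
  "specht_iso i D U \<longleftrightarrow>
     (\<exists>\<phi>. bij_betw \<phi> (specht i D) U \<and>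
          (\<forall>u\<in>specht i D. \<forall>v\<in>specht i D. \<phi> (u + v) = \<phi> u + \<phi> v) \<and>
          (\<forall>c. \<forall>v\<in>specht i D. \<phi> (cscale c v) = cscale c (\<phi> v)) \<and>
          (\<forall>\<sigma>. \<sigma> permutes {..<i} \<longrightarrow>
             (\<forall>v\<in>specht i D. \<phi> (tabloid_act \<sigma> v) = word_act \<sigma> (\<phi> v))))"

definition isotypic :: "nat \<Rightarrow> nat \<Rightarrow> nat \<Rightarrow> diagram \<Rightarrow> (word \<Rightarrow> complex) set" where
  "isotypic n k i D = cfun.span (\<Union>{U. word_submodule n k i U \<and> specht_iso i D U})"

definition chain_space :: "nat \<Rightarrow> nat \<Rightarrow> diagram list \<Rightarrow> (word \<Rightarrow> complex) set" where
  "chain_space n k ch =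
     {f \<in> word_funs n k. \<forall>j < length ch. f \<in> isotypic n k (Suc j) (ch ! j)}"

definition suffix_space :: "nat \<Rightarrow> nat \<Rightarrow> word \<Rightarrow> (word \<Rightarrow> complex) set" where
  "suffix_space n k c = cfun.span {delta w | w. w \<in> words n k \<and> drop (n - length c) w = c}"


section \<open>Intermediate bases\<close>

type_synonym label = "diagram list \<times> word"

text \<open>
  The condition \<open>a \<le> min (r, i - r)\<close> is over the integers, so it includes \<open>r \<le> i\<close>.
  For \<open>i = 0\<close> the chain is empty and the condition on its last diagram is void.
\<close>

definition labels :: "nat \<Rightarrow> nat \<Rightarrow> nat \<Rightarrow> label set" where
  "labels n k i =
     {(ch, c). length ch = i \<and> diagram_chain ch \<and>
        length c = n - i \<and> set c \<subseteq> {1, 2} \<and>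
        (\<exists>r a. r \<le> k \<and> count_list c 1 = k - r \<and> a \<le> r \<and> a + r \<le> i \<and>
               (i > 0 \<longrightarrow> last ch = two_row (i - a) a))}"

text \<open>
  A family indexed by \<open>labels n k i\<close>: one unit vector in each of the one-dimensional subspaces.
\<close>

definition intermediate_basis :: "nat \<Rightarrow> nat \<Rightarrow> nat \<Rightarrow> (label \<Rightarrow> word \<Rightarrow> complex) \<Rightarrow> bool" where
  "intermediate_basis n k i b \<longleftrightarrow>
     (\<forall>(ch, c) \<in> labels n k i.
        b (ch, c) \<in> chain_space n k ch \<inter> suffix_space n k c \<and>
        word_inner n k (b (ch, c)) (b (ch, c)) = 1 \<and>
        (i = 0 \<longrightarrow> b (ch, c) = delta c))"

definition coords :: "'l set \<Rightarrow> ('l \<Rightarrow> 'a \<Rightarrow> complex) \<Rightarrow> ('a \<Rightarrow> complex) \<Rightarrow> 'l \<Rightarrow> complex" where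
  "coords L b f = (\<lambda>l. cfun.representation (b ` L) f (b l))"

text \<open>
  Entry in row \<open>l'\<close> and column \<open>l\<close> of the matrix whose columns are the members of the family \<open>b\<close>
  written in the basis \<open>b'\<close>, which is indexed by \<open>L'\<close>.
\<close>

definition change_matrix ::
  "'l set \<Rightarrow> ('l \<Rightarrow> 'a \<Rightarrow> complex) \<Rightarrow> ('m \<Rightarrow> 'a \<Rightarrow> complex) \<Rightarrow> 'l \<Rightarrow> 'm \<Rightarrow> complex" where
  "change_matrix L' b' b = (\<lambda>l' l. coords L' b' (b l) l')"


section \<open>Counting operations\<close>

text \<open>
  Straight-line programs over the complex numbers.  One instruction \<open>(x, y, z)\<close> is one operation:
  it computes \<open>x + y * z\<close> and appends the result to the registers.  Selecting operands
  and outputs is storage and is free.  The constants 0 and 1 make a single multiplication or a single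
  addition an instruction; no other constants are available.
\<close>

datatype 'v operand = Const0 | Const1 | Input 'v | Reg nat

type_synonym 'v program = "('v operand \<times> 'v operand \<times> 'v operand) list"

fun operand_value :: "('v \<Rightarrow> complex) \<Rightarrow> complex list \<Rightarrow> 'v operand \<Rightarrow> complex" where
  "operand_value env regs Const0 = 0"
| "operand_value env regs Const1 = 1"
| "operand_value env regs (Input v) = env v"
| "operand_value env regs (Reg j) = (if j < length regs then regs ! j else 0)"

fun run :: "('v \<Rightarrow> complex) \<Rightarrow> 'v program \<Rightarrow> complex list \<Rightarrow> complex list" where
  "run env [] regs = regs"
| "run env ((x, y, z) # P) regs =
     run env P (regs @ [operand_value env regs x + operand_value env regs y * operand_value env regs z])"

definition program_output ::
  "('v \<Rightarrow> complex) \<Rightarrow> 'v program \<Rightarrow> ('l \<Rightarrow> 'v operand) \<Rightarrow> 'l \<Rightarrow> complex" where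
  "program_output env P out = (\<lambda>l. operand_value env (run env P []) (out l))"

text \<open>
  The inputs of the computation: the coordinates in \<open>B 0\<close> of the given function, and the entries
  (row, column) of the matrices from \<open>B (i - 1)\<close> to \<open>B i\<close> for \<open>i = 2, \<dots>, n\<close>.
  Other input names yield 0.
\<close>

datatype input = Coord label | Entry nat label label

definition input_env ::
  "nat \<Rightarrow> nat \<Rightarrow> (nat \<Rightarrow> label \<Rightarrow> word \<Rightarrow> complex) \<Rightarrow> (word \<Rightarrow> complex) \<Rightarrow> input \<Rightarrow> complex" where
  "input_env n k B f v =
     (case v of
        Coord l \<Rightarrow> (if l \<in> labels n k 0 then coords (labels n k 0) (B 0) f l else 0)
      | Entry i l' l \<Rightarrow>
          (if 2 \<le> i \<and> i \<le> n \<and> l' \<in> labels n k i \<and> l \<in> labels n k (i - 1)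
           then change_matrix (labels n k i) (B i) (B (i - 1)) l' l else 0))"

end

theory Submission
  imports Defs
begin

text \<open>
  The sum of all transpositions of \<open>S\<^sub>m\<close> acts on the two-row Specht module of shape \<open>(m - a, a)\<close> by a
  real scalar, and these scalars are distinct for distinct \<open>a\<close>.  It is self-adjoint on functions on
  words, so isotypic components of distinct two-row shapes are orthogonal.  Hence each intermediate
  family is orthonormal; it is a basis because it has at least \<open>n choose k\<close> members, and coordinates are
  inner products.  A member of \<open>B\<^sub>i\<close> with label \<open>(\<lambda>\<^sub>1 \<dots> \<lambda>\<^sub>i, c)\<close> is orthogonal to all members of
  \<open>B\<^sub>i\<^sub>-\<^sub>1\<close> except the two labelled \<open>(\<lambda>\<^sub>1 \<dots> \<lambda>\<^sub>i\<^sub>-\<^sub>1, 1c)\<close> and \<open>(\<lambda>\<^sub>1 \<dots> \<lambda>\<^sub>i\<^sub>-\<^sub>1, 2c)\<close>, so each row of the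
  matrix from \<open>B\<^sub>i\<^sub>-\<^sub>1\<close> to \<open>B\<^sub>i\<close> has at most two nonzero entries and costs two operations.
\<close>


section \<open>Transpositions on two-row Specht modules\<close>

lemma sum_apply_fun:
  fixes f :: "'b \<Rightarrow> 'a \<Rightarrow> 'c::comm_monoid_add"
  shows "(\<Sum>a\<in>A. f a) x = (\<Sum>a\<in>A. f a x)"
  by (induction A rule: infinite_finite_induct) auto

lemma permutes_less_iff:
  fixes i :: nat
  assumes "\<sigma> permutes {..<i}"
  shows "\<sigma> x < i \<longleftrightarrow> x < i"
  using permutes_in_image[OF assms, of x] by simp

lemma transpose_permutes_lessThan:
  "p < i \<Longrightarrow> q < i \<Longrightarrow> transpose p q permutes {..<i::nat}"
  by (intro permutes_swap_id) auto

lemma tabloid_comp: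
  assumes "\<sigma> permutes {..<i}"
  shows "tabloid i t \<circ> \<sigma> = tabloid i (t \<circ> \<sigma>)"
  using permutes_less_iff[OF assms] by (auto simp: tabloid_def restrict_def fun_eq_iff)

lemma comp_permutes_eq_iff:
  assumes "\<sigma> permutes S"
  shows "f \<circ> \<sigma> = g \<longleftrightarrow> f = g \<circ> inv \<sigma>"
  using permutes_inv_o[OF assms] by (auto simp: comp_assoc)

lemma polytabloid_apply:
  "polytabloid i t T =
     (\<Sum>\<pi>\<in>column_stabilizer i t. of_int (sign \<pi>) * (if T = tabloid i (t \<circ> inv \<pi>) then 1 else 0))"
  by (simp add: polytabloid_def sum_apply_fun cscale_def delta_def)

section \<open>Column stabilizers and polytabloids under permutations of the letters\<close>

lemma column_stabilizer_comp:
  assumes "\<sigma> \<in> column_stabilizer i t" "\<pi> \<in> column_stabilizer i t"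
  shows "\<sigma> \<circ> \<pi> \<in> column_stabilizer i t"
  using assms permutes_less_iff by (auto simp: column_stabilizer_def intro: permutes_compose)

lemma column_stabilizer_inv:
  assumes "\<sigma> \<in> column_stabilizer i t"
  shows "inv \<sigma> \<in> column_stabilizer i t"
proof -
  have p: "\<sigma> permutes {..<i}" and c: "\<And>m. m < i \<Longrightarrow> snd (t (\<sigma> m)) = snd (t m)"
    using assms by (auto simp: column_stabilizer_def)
  have "snd (t (inv \<sigma> m)) = snd (t m)" if "m < i" for m
    using c[of "inv \<sigma> m"] permutes_less_iff[OF permutes_inv[OF p], of m] that
    by (simp add: permutes_inverses[OF p])
  then show ?thesis
    using permutes_inv[OF p] by (auto simp: column_stabilizer_def)
qed

lemma comp_tabloid_eq_iff:
  assumes "\<sigma> permutes {..<i}" "\<pi> permutes {..<i}"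
  shows "T \<circ> \<sigma> = tabloid i (t \<circ> inv \<pi>) \<longleftrightarrow> T = tabloid i (t \<circ> inv (\<sigma> \<circ> \<pi>))"
proof -
  have "inv (\<sigma> \<circ> \<pi>) = inv \<pi> \<circ> inv \<sigma>"
    using assms by (intro o_inv_distrib permutes_bij)
  then show ?thesis
    using assms by (simp add: comp_permutes_eq_iff tabloid_comp permutes_inv comp_assoc)
qed

lemma sign_lessThan_comp:
  assumes "\<sigma> permutes {..<i::nat}" "\<pi> permutes {..<i}"
  shows "sign (\<sigma> \<circ> \<pi>) = sign \<sigma> * sign \<pi>"
  using assms by (meson finite_lessThan permutes_imp_permutation sign_compose)

text \<open>Left multiplication by \<open>\<sigma>\<close> permutes the column stabilizer,
  multiplies every sign by \<open>sign \<sigma>\<close>, and turns the condition on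
  \<open>T \<circ> \<sigma>\<close> into one on \<open>T\<close>.\<close>

lemma polytabloid_column_sign:
  assumes \<sigma>: "\<sigma> \<in> column_stabilizer i t"
  shows "polytabloid i t (T \<circ> \<sigma>) = of_int (sign \<sigma>) * polytabloid i t T"
proof -
  let ?C = "column_stabilizer i t"
  have p: "\<sigma> permutes {..<i}" using \<sigma> by (simp add: column_stabilizer_def)
  have bij: "bij_betw (\<lambda>\<pi>. \<sigma> \<circ> \<pi>) ?C ?C"
    by (rule bij_betw_byWitness[where f' = "\<lambda>\<pi>. inv \<sigma> \<circ> \<pi>"])
       (use column_stabilizer_comp column_stabilizer_inv[OF \<sigma>] \<sigma> permutes_inv_o[OF p] in
         \<open>auto simp flip: comp_assoc\<close>)
  have "of_int (sign \<sigma>) * polytabloid i t T =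
      (\<Sum>\<pi>\<in>?C. of_int (sign \<sigma>) *
         (of_int (sign (\<sigma> \<circ> \<pi>)) * (if T = tabloid i (t \<circ> inv (\<sigma> \<circ> \<pi>)) then 1 else 0)))"
    unfolding polytabloid_apply sum_distrib_left
    by (subst sum.reindex_bij_betw[OF bij, symmetric]) simp
  also have "\<dots> = (\<Sum>\<pi>\<in>?C. of_int (sign \<pi>) * (if T \<circ> \<sigma> = tabloid i (t \<circ> inv \<pi>) then 1 else 0))"
  proof (rule sum.cong)
    fix \<pi> assume "\<pi> \<in> ?C"
    then have q: "\<pi> permutes {..<i}" by (simp add: column_stabilizer_def)
    show "of_int (sign \<sigma>) *
         (of_int (sign (\<sigma> \<circ> \<pi>)) * (if T = tabloid i (t \<circ> inv (\<sigma> \<circ> \<pi>)) then 1 else 0)) =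
       (of_int (sign \<pi>) * (if T \<circ> \<sigma> = tabloid i (t \<circ> inv \<pi>) then 1 else 0) :: complex)"
      unfolding comp_tabloid_eq_iff[OF p q] sign_lessThan_comp[OF p q]
      by (simp add: sign_def)
  qed simp
  finally show ?thesis by (simp add: polytabloid_apply)
qed

text \<open>Conjugation by \<open>\<sigma>\<close> carries the column stabilizer of \<open>t\<close>
  to that of \<open>t \<circ> inv \<sigma>\<close> and preserves signs.\<close>

lemma tabloid_act_polytabloid:
  assumes p: "\<sigma> permutes {..<i}"
  shows "tabloid_act \<sigma> (polytabloid i t) = polytabloid i (t \<circ> inv \<sigma>)"
proof
  fix T
  let ?C = "column_stabilizer i"
  have ip: "inv \<sigma> permutes {..<i}" by (rule permutes_inv[OF p])
  have c1: "\<sigma> \<circ> \<pi> \<circ> inv \<sigma> \<in> ?C (t \<circ> inv \<sigma>)" if "\<pi> \<in> ?C t" for \<pi>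
    using that permutes_less_iff[OF ip] permutes_inverses[OF p] p ip
    by (auto simp: column_stabilizer_def intro!: permutes_compose)
  have c2: "inv \<sigma> \<circ> \<pi> \<circ> \<sigma> \<in> ?C t" if "\<pi> \<in> ?C (t \<circ> inv \<sigma>)" for \<pi>
  proof -
    have "\<pi> permutes {..<i}" "\<And>m. m < i \<Longrightarrow> snd (t (inv \<sigma> (\<pi> m))) = snd (t (inv \<sigma> m))"
      using that by (auto simp: column_stabilizer_def)
    then show ?thesis
      using permutes_less_iff[OF p] permutes_inverses[OF p] p ip
      by (auto simp: column_stabilizer_def intro!: permutes_compose)
  qed
  have bij: "bij_betw (\<lambda>\<pi>. \<sigma> \<circ> \<pi> \<circ> inv \<sigma>) (?C t) (?C (t \<circ> inv \<sigma>))"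
    by (rule bij_betw_byWitness[where f' = "\<lambda>\<pi>. inv \<sigma> \<circ> \<pi> \<circ> \<sigma>"])
       (use c1 c2 in \<open>auto simp: fun_eq_iff permutes_inverses[OF p]\<close>)
  have "polytabloid i (t \<circ> inv \<sigma>) T =
     (\<Sum>\<pi>\<in>?C t. of_int (sign (\<sigma> \<circ> \<pi> \<circ> inv \<sigma>)) *
       (if T = tabloid i (t \<circ> inv \<sigma> \<circ> inv (\<sigma> \<circ> \<pi> \<circ> inv \<sigma>)) then 1 else 0))"
    unfolding polytabloid_apply by (subst sum.reindex_bij_betw[OF bij, symmetric]) simp
  also have "\<dots> = (\<Sum>\<pi>\<in>?C t. of_int (sign \<pi>) * (if T \<circ> \<sigma> = tabloid i (t \<circ> inv \<pi>) then 1 else 0))"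
  proof (rule sum.cong)
    fix \<pi> assume "\<pi> \<in> ?C t"
    then have q: "\<pi> permutes {..<i}" by (simp add: column_stabilizer_def)
    have *: "inv (\<sigma> \<circ> \<pi> \<circ> inv \<sigma>) = \<sigma> \<circ> inv (\<sigma> \<circ> \<pi>)"
      using o_inv_distrib[OF permutes_bij[OF permutes_compose[OF q p]] permutes_bij[OF ip]]
        permutes_inv_inv[OF p] by simp
    have "t \<circ> inv \<sigma> \<circ> inv (\<sigma> \<circ> \<pi> \<circ> inv \<sigma>) = t \<circ> inv (\<sigma> \<circ> \<pi>)"
      unfolding * by (simp add: fun_eq_iff permutes_inverses[OF p])
    moreover have "sign (\<sigma> \<circ> \<pi> \<circ> inv \<sigma>) = sign \<pi>"
    proof -
      have "sign (inv \<sigma>) = sign \<sigma>"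
        using p by (meson finite_lessThan permutes_imp_permutation sign_inverse)
      then show ?thesis
        using sign_lessThan_comp[OF permutes_compose[OF q p] ip] sign_lessThan_comp[OF p q]
        by (simp add: sign_def)
    qed
    ultimately show "of_int (sign (\<sigma> \<circ> \<pi> \<circ> inv \<sigma>)) *
       (if T = tabloid i (t \<circ> inv \<sigma> \<circ> inv (\<sigma> \<circ> \<pi> \<circ> inv \<sigma>)) then 1 else 0) =
       (of_int (sign \<pi>) * (if T \<circ> \<sigma> = tabloid i (t \<circ> inv \<pi>) then 1 else 0) :: complex)"
      by (simp add: comp_tabloid_eq_iff[OF p q])
  qed simp
  finally show "tabloid_act \<sigma> (polytabloid i t) T = polytabloid i (t \<circ> inv \<sigma>) T"
    by (simp add: polytabloid_apply tabloid_act_def)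
qed

lemma tabloid_act_specht:
  assumes p: "\<sigma> permutes {..<i}" and v: "v \<in> specht i D"
  shows "tabloid_act \<sigma> v \<in> specht i D"
  using v unfolding specht_def
proof (induction rule: cfun.span_induct_alt)
  case base
  have "tabloid_act \<sigma> (0 :: tabloid \<Rightarrow> complex) = 0" by (simp add: tabloid_act_def fun_eq_iff)
  then show ?case using cfun.span_zero by metis
next
  case (step c x y)
  then obtain t where t: "x = polytabloid i t" "tableau i D t" by blast
  have "bij_betw (t \<circ> inv \<sigma>) {..<i} D"
    using t(2) permutes_inv[OF p]
    by (auto simp: tableau_def intro: bij_betw_trans permutes_imp_bij)
  then have "tabloid_act \<sigma> x \<in> cfun.span {polytabloid i t |t. tableau i D t}"
    unfolding t(1) tabloid_act_polytabloid[OF p]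
    by (intro cfun.span_base) (auto simp: tableau_def)
  moreover have "tabloid_act \<sigma> (cscale c x + y) = cscale c (tabloid_act \<sigma> x) + tabloid_act \<sigma> y"
    by (simp add: tabloid_act_def cscale_def fun_eq_iff)
  ultimately show ?case
    using step.IH by (simp only: cfun.span_add cfun.span_scale)
qed

text \<open>The tabloids of shape \<open>(m - a, a)\<close> described without tableaux, as indicator
  functions of \<open>a\<close>-subsets of the letters. Being \<open>extensional\<close> matches the
  \<open>restrict\<close> in \<open>tabloid\<close>.\<close>

definition tabloid_shape :: "nat \<Rightarrow> nat \<Rightarrow> tabloid set" where
  "tabloid_shape m a =
     {T. T \<in> extensional {..<m} \<and> T ` {..<m} \<subseteq> {0, 1} \<and> card {x. x < m \<and> T x = 1} = a}"

lemma tabloid_shape_comp: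
  assumes "\<sigma> permutes {..<m}"
  shows "T \<circ> \<sigma> \<in> tabloid_shape m a \<longleftrightarrow> T \<in> tabloid_shape m a"
proof -
  have *: "T \<circ> \<sigma> \<in> tabloid_shape m a"
    if T: "T \<in> tabloid_shape m a" and p: "\<sigma> permutes {..<m}" for T \<sigma>
  proof -
    note lt = permutes_less_iff[OF p]
    have "bij_betw \<sigma> {x. x < m \<and> (T \<circ> \<sigma>) x = 1} {x. x < m \<and> T x = 1}"
      by (rule bij_betw_byWitness[where f' = "inv \<sigma>"])
         (auto simp: permutes_inverses[OF p] lt permutes_less_iff[OF permutes_inv[OF p]])
    then have "card {x. x < m \<and> (T \<circ> \<sigma>) x = 1} = card {x. x < m \<and> T x = 1}"
      by (rule bij_betw_same_card)
    moreover have "T \<circ> \<sigma> \<in> extensional {..<m}"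
      using T lt by (simp add: tabloid_shape_def extensional_def)
    moreover have "(T \<circ> \<sigma>) ` {..<m} \<subseteq> {0, 1}"
      using T lt by (simp add: tabloid_shape_def image_subset_iff)
    ultimately show ?thesis
      using T by (simp add: tabloid_shape_def)
  qed
  have "T \<circ> \<sigma> \<circ> inv \<sigma> = T"
    by (simp add: fun_eq_iff permutes_inverses[OF assms])
  then show ?thesis
    using *[OF _ assms, of T] *[OF _ permutes_inv[OF assms], of "T \<circ> \<sigma>"] by auto
qed

lemma two_row_iff: "(r, c) \<in> two_row p q \<longleftrightarrow> r = 0 \<and> c < p \<or> r = 1 \<and> c < q"
  by (auto simp: two_row_def)

lemma tabloid_in_shape:
  assumes "tableau m (two_row p a) t"
  shows "tabloid m t \<in> tabloid_shape m a"
proof -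
  have b: "bij_betw t {..<m} (two_row p a)" using assms by (simp add: tableau_def)
  have "bij_betw t {x. x < m \<and> fst (t x) = 1} ({1} \<times> {..<a})"
  proof (rule bij_betw_subset[OF b])
    show "t ` {x. x < m \<and> fst (t x) = 1} = {1} \<times> {..<a}"
    proof (intro equalityI subsetI)
      fix y assume "y \<in> {1::nat} \<times> {..<a}"
      then have "y \<in> two_row p a" "fst y = 1" by (auto simp: two_row_def)
      then show "y \<in> t ` {x. x < m \<and> fst (t x) = 1}"
        using bij_betw_imp_surj_on[OF b] by (force simp: image_iff)
    qed (use bij_betwE[OF b] in \<open>force simp: two_row_def\<close>)
  qed auto
  then have "card {x. x < m \<and> fst (t x) = 1} = a"
    by (simp add: bij_betw_same_card[of t])
  moreover have "{x. x < m \<and> tabloid m t x = 1} = {x. x < m \<and> fst (t x) = 1}"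
    by (auto simp: tabloid_def)
  ultimately show ?thesis
    using bij_betwE[OF b] by (force simp: tabloid_shape_def tabloid_def two_row_def)
qed

text \<open>A column permutation only renames letters, so it keeps the number of letters in the
  second row.\<close>

lemma polytabloid_support:
  assumes t: "tableau m (two_row p a) t" and T: "T \<notin> tabloid_shape m a"
  shows "polytabloid m t T = 0"
  unfolding polytabloid_apply
proof (intro sum.neutral ballI)
  fix \<pi> assume "\<pi> \<in> column_stabilizer m t"
  then have q: "inv \<pi> permutes {..<m}" by (simp add: column_stabilizer_def permutes_inv)
  have "tabloid m (t \<circ> inv \<pi>) \<in> tabloid_shape m a"
    using tabloid_in_shape[OF t] tabloid_shape_comp[OF q] by (simp flip: tabloid_comp[OF q])
  then show "of_int (sign \<pi>) * (if T = tabloid m (t \<circ> inv \<pi>) then 1 else 0) = (0::complex)"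
    using T by auto
qed

text \<open>
  Move a letter \<open>p\<close> of the second row upwards.  By the pigeonhole principle some column
  \<open>{x, y}\<close> is missed by the other letters of the second row, and the polytabloid changes sign
  under the exchange of \<open>x\<close> and \<open>y\<close>: only the terms for \<open>x\<close> and \<open>y\<close> survive, and they cancel.
\<close>

lemma polytabloid_harmonic:
  assumes t: "tableau m (two_row (m - a) a) t" and a: "2 * a \<le> m"
    and T: "T \<in> tabloid_shape m a" and p: "p < m" "T p = 1"
  shows "(\<Sum>q | q < m \<and> T q = 0. polytabloid m t (T \<circ> transpose p q)) = - polytabloid m t T"
proof -
  let ?e = "polytabloid m t"
  have b: "bij_betw t {..<m} (two_row (m - a) a)" using t by (simp add: tableau_def)
  define R where "R = {x. x < m \<and> T x = 1} - {p}"
  have cA: "card {x. x < m \<and> T x = 1} = a" using T by (simp add: tabloid_shape_def)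
  have "finite R" by (simp add: R_def)
  moreover have "card R < a"
    unfolding R_def cA[symmetric] by (rule card_Diff1_less) (use p in auto)
  ultimately  have "\<not> {..<a} \<subseteq> (snd \<circ> t) ` R"
    using card_mono[of "(snd \<circ> t) ` R" "{..<a}"] card_image_le[of R "snd \<circ> t"] by auto
  then obtain j where j: "j < a" "j \<notin> (snd \<circ> t) ` R" by blast
  have "(0, j) \<in> t ` {..<m}" "(1, j) \<in> t ` {..<m}"
    using j a bij_betw_imp_surj_on[OF b] by (auto simp: two_row_iff)
  then obtain x y where xy: "x < m" "t x = (0, j)" "y < m" "t y = (1, j)" by force
  then have neq: "x \<noteq> y" by auto
  have nR: "x \<notin> R" "y \<notin> R" using j xy by (force simp: image_iff)+
  have st: "transpose x y \<in> column_stabilizer m t"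
    using xy transpose_permutes_lessThan[of x m y]
    by (auto simp: column_stabilizer_def transpose_def)
  have anti: "?e (U \<circ> transpose x y) = - ?e U" for U
    using polytabloid_column_sign[OF st] neq by (simp add: sign_swap_id)
  have T01: "T z = 0 \<or> T z = 1" if "z < m" for z
    using T that by (auto simp: tabloid_shape_def image_subset_iff)
  let ?Q = "{q. q < m \<and> q \<notin> R}"
  have Q: "T q = 0" if "q \<in> ?Q" "q \<noteq> p" for q using that T01[of q] by (auto simp: R_def)
  have xyQ: "x \<in> ?Q" "y \<in> ?Q" using xy nR by auto
  have z: "?e (T \<circ> transpose p q) = 0" if "q \<in> ?Q - {x, y}" for q
  proof -
    have "T \<circ> transpose p q \<circ> transpose x y = T \<circ> transpose p q"
      using that Q[OF xyQ(1)] Q[OF xyQ(2)] Q[of q] neq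
      by (auto simp: fun_eq_iff transpose_def)
    then show ?thesis using anti[of "T \<circ> transpose p q"] by simp
  qed
  have "T \<circ> transpose p x \<circ> transpose x y = T \<circ> transpose p y"
    using Q[OF xyQ(1)] Q[OF xyQ(2)] neq p
    by (auto simp: fun_eq_iff transpose_def)
  then have "?e (T \<circ> transpose p y) = - ?e (T \<circ> transpose p x)"
    using anti[of "T \<circ> transpose p x"] by simp
  moreover have "(\<Sum>q\<in>?Q. ?e (T \<circ> transpose p q)) = (\<Sum>q\<in>{x, y}. ?e (T \<circ> transpose p q))"
    by (rule sum.mono_neutral_right) (use z xyQ in auto)
  ultimately have "(\<Sum>q\<in>?Q. ?e (T \<circ> transpose p q)) = 0"
    using neq by simp
  \<comment> \<open>\<open>?Q\<close> contains \<open>p\<close>, whose term is the polytabloid at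
    \<open>T\<close> itself; moving it to the other side gives the minus sign.\<close>
  moreover have "?Q = insert p {q. q < m \<and> T q = 0}"
    using p T01 by (auto simp: R_def)
  ultimately show ?thesis using p by (simp add: add_eq_0_iff2)
qed

text \<open>
  Sums of transpositions run over all ordered pairs of letters, including equal ones, so the
  eigenvalue is \<open>m\<close> plus twice the sum of the contents of the boxes of \<open>(m - a, a)\<close>.
\<close>

definition content_value :: "nat \<Rightarrow> nat \<Rightarrow> complex" where
  "content_value m a = of_nat (a * a) + of_nat ((m - a) * (m - a)) - 2 * of_nat a"

text \<open>Two letters in the same row of \<open>T\<close> can be exchanged without changing
  \<open>T\<close>, which gives the two squares. For each of the \<open>a\<close> letters of the
  second row the exchanges with the first row add up to minus the value at \<open>T\<close>; mixed
  pairs occur in both orders, hence \<open>- 2 * a\<close>.\<close>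

lemma polytabloid_swap_sum:
  assumes t: "tableau m (two_row (m - a) a) t" and a: "2 * a \<le> m"
  shows "(\<Sum>p<m. \<Sum>q<m. polytabloid m t (T \<circ> transpose p q)) = content_value m a * polytabloid m t T"
proof (cases "T \<in> tabloid_shape m a")
  case False
  have "polytabloid m t (T \<circ> transpose p q) = 0" if "p < m" "q < m" for p q
    using that False tabloid_shape_comp[OF transpose_permutes_lessThan[OF that]]
    by (intro polytabloid_support[OF t]) auto
  then show ?thesis using polytabloid_support[OF t False] by simp
next
  case True
  let ?e = "polytabloid m t"
  let ?A = "{x. x < m \<and> T x = 1}" and ?Z = "{x. x < m \<and> T x = 0}"
  have T01: "T z = 0 \<or> T z = 1" if "z < m" for z
    using True that by (auto simp: tabloid_shape_def image_subset_iff)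
  have un: "{..<m} = ?A \<union> ?Z" by (auto dest: T01 simp del: neq0_conv)
  have split: "(\<Sum>q<m. g q) = (\<Sum>q\<in>?A. g q) + (\<Sum>q\<in>?Z. g q)" for g :: "nat \<Rightarrow> complex"
    unfolding un by (subst sum.union_disjoint) auto
  have cA: "card ?A = a" using True by (simp add: tabloid_shape_def)
  moreover have "card (?A \<union> ?Z) = card ?A + card ?Z"
    by (rule card_Un_disjoint) auto
  then have "card ?A + card ?Z = m"
    using un by (metis card_lessThan)
  ultimately have cZ: "card ?Z = m - a" by simp
  have same: "T \<circ> transpose p q = T" if "T p = T q" for p q
    using that by (auto simp: fun_eq_iff transpose_def)
  have h: "(\<Sum>p\<in>?A. \<Sum>q\<in>?Z. ?e (T \<circ> transpose p q)) = - of_nat a * ?e T"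
    using polytabloid_harmonic[OF t a True] cA by simp
  have h': "(\<Sum>p\<in>?Z. \<Sum>q\<in>?A. ?e (T \<circ> transpose p q)) = - of_nat a * ?e T"
    by (subst sum.swap) (use h in \<open>simp add: transpose_commute\<close>)
  have "(\<Sum>p\<in>?A. \<Sum>q\<in>?A. ?e (T \<circ> transpose p q)) = of_nat (a * a) * ?e T"
    using cA by (simp add: same)
  moreover have "(\<Sum>p\<in>?Z. \<Sum>q\<in>?Z. ?e (T \<circ> transpose p q)) = of_nat ((m - a) * (m - a)) * ?e T"
    using cZ by (simp add: same)
  ultimately show ?thesis
    using h h' by (simp add: split sum.distrib content_value_def algebra_simps)
qed

lemma specht_swap_sum:
  assumes v: "v \<in> specht m (two_row (m - a) a)" and a: "2 * a \<le> m"
  shows "(\<Sum>p<m. \<Sum>q<m. tabloid_act (transpose p q) v) = cscale (content_value m a) v"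
  using v unfolding specht_def
proof (induction rule: cfun.span_induct_alt)
  case base
  show ?case by (simp add: fun_eq_iff sum_apply_fun tabloid_act_def cscale_def)
next
  case (step c x y)
  then obtain t where t: "x = polytabloid m t" "tableau m (two_row (m - a) a) t" by blast
  show ?case
  proof
    fix T
    have "(\<Sum>p<m. \<Sum>q<m. tabloid_act (transpose p q) y) T = cscale (content_value m a) y T"
      using step.IH by simp
    then show "(\<Sum>p<m. \<Sum>q<m. tabloid_act (transpose p q) (cscale c x + y)) T =
          cscale (content_value m a) (cscale c x + y) T"
      using polytabloid_swap_sum[OF t(2) a, of T] unfolding t(1)
      by (simp add: sum_apply_fun tabloid_act_def cscale_def sum.distrib algebra_simps
          flip: sum_distrib_left)
  qed
qed

text \<open>The difference of the two values factors as
  \<open>2 * (a - b) * (a + b - m - 1)\<close>, and the last factor is negative because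
  \<open>a + b \<le> m\<close>.\<close>

lemma content_value_inj:
  assumes "content_value m a = content_value m b" "2 * a \<le> m" "2 * b \<le> m"
  shows "a = b"
proof (rule ccontr)
  assume "a \<noteq> b"
  \<comment> \<open>\<open>c\<close> and \<open>d\<close> stand for \<open>m - a\<close> and
    \<open>m - b\<close>, so that the truncated subtraction can be replaced by integer
    arithmetic.\<close>
  obtain c d where cd: "m = a + c" "m = b + d"
    using assms(2,3) by (metis le_add2 le_trans mult_2 nat_le_iff_add)
  have "of_int (int (a * a) + int (c * c) - 2 * int a) = content_value m a"
    "of_int (int (b * b) + int (d * d) - 2 * int b) = content_value m b"
    by (simp_all add: content_value_def cd(1)) (simp add: cd flip: cd(1))
  then have "int (a * a) + int (c * c) - 2 * int a = int (b * b) + int (d * d) - 2 * int b"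
    using assms(1) by (metis of_int_eq_iff)
  moreover have "int c = int m - int a" "int d = int m - int b" using cd by auto
  ultimately have "2 * (int a - int b) * (int a + int b - int m - 1) = 0"
    by (simp add: algebra_simps)
  then show False using \<open>a \<noteq> b\<close> assms(2,3) by auto
qed


section \<open>Orthogonality of isotypic components\<close>

lemma word_inner_scale_left: "word_inner n k (cscale c f) h = c * word_inner n k f h"
  by (simp add: word_inner_def cscale_def sum_distrib_left algebra_simps)

lemma word_inner_scale_right: "word_inner n k h (cscale c f) = cnj c * word_inner n k h f"
  by (simp add: word_inner_def cscale_def sum_distrib_left algebra_simps)

lemma word_inner_sum_left: "word_inner n k (\<Sum>a\<in>A. f a) h = (\<Sum>a\<in>A. word_inner n k (f a) h)"
  unfolding word_inner_def sum_apply_fun sum_distrib_right by (rule sum.swap)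

lemma word_inner_sum_right: "word_inner n k h (\<Sum>a\<in>A. f a) = (\<Sum>a\<in>A. word_inner n k h (f a))"
  unfolding word_inner_def sum_apply_fun cnj_sum sum_distrib_left by (rule sum.swap)

text \<open>The isomorphism transports the eigenvalue equation of the Specht module. Since it is
  linear and equivariant only on that module, all translates and partial sums must first be shown to
  lie there.\<close>

lemma specht_iso_swap_sum:
  assumes "specht_iso m (two_row (m - a) a) U" and f: "f \<in> U" and a: "2 * a \<le> m"
  shows "(\<Sum>p<m. \<Sum>q<m. word_act (transpose p q) f) = cscale (content_value m a) f"
proof -
  let ?S = "specht m (two_row (m - a) a)"
  obtain \<phi> where bij: "bij_betw \<phi> ?S U"
    and add: "\<And>u v. u \<in> ?S \<Longrightarrow> v \<in> ?S \<Longrightarrow> \<phi> (u + v) = \<phi> u + \<phi> v"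
    and scale: "\<And>c v. v \<in> ?S \<Longrightarrow> \<phi> (cscale c v) = cscale c (\<phi> v)"
    and equivar: "\<And>\<sigma> v. \<sigma> permutes {..<m} \<Longrightarrow> v \<in> ?S \<Longrightarrow> \<phi> (tabloid_act \<sigma> v) = word_act \<sigma> (\<phi> v)"
    using assms(1) unfolding specht_iso_def by blast
  obtain v where v: "v \<in> ?S" "f = \<phi> v"
    using bij f by (auto simp: bij_betw_def)
  have zero: "0 \<in> ?S" by (simp add: specht_def cfun.span_zero)
  have phi0: "\<phi> 0 = 0" using scale[OF zero, of 0] by simp
  have sum_in: "(\<Sum>x\<in>A. g x) \<in> ?S" if "\<And>x. x \<in> A \<Longrightarrow> g x \<in> ?S" for g :: "nat \<Rightarrow> _" and A
    using that unfolding specht_def by (intro cfun.span_sum) auto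
  have phi_sum: "\<phi> (\<Sum>x\<in>A. g x) = (\<Sum>x\<in>A. \<phi> (g x))"
    if "finite A" "\<And>x. x \<in> A \<Longrightarrow> g x \<in> ?S" for g :: "nat \<Rightarrow> _" and A
    using that
  proof (induction A rule: finite_induct)
    case (insert x A)
    then have "\<phi> (g x + sum g A) = \<phi> (g x) + (\<Sum>x\<in>A. \<phi> (g x))"
      using add[of "g x" "sum g A"] sum_in[of A g] by simp
    then show ?case by (simp only: sum.insert[OF insert.hyps])
  qed (simp add: phi0)
  have act: "tabloid_act (transpose p q) v \<in> ?S" if "p < m" "q < m" for p q
    using that v(1) by (intro tabloid_act_specht transpose_permutes_lessThan)
  have "(\<Sum>p<m. \<Sum>q<m. word_act (transpose p q) f) =
      (\<Sum>p<m. \<Sum>q<m. \<phi> (tabloid_act (transpose p q) v))"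
    by (intro sum.cong refl) (simp add: v equivar transpose_permutes_lessThan)
  also have "\<dots> = \<phi> (\<Sum>p<m. \<Sum>q<m. tabloid_act (transpose p q) v)"
    by (subst phi_sum) (auto intro!: sum_in act sum.cong phi_sum[symmetric])
  also have "\<dots> = cscale (content_value m a) f"
    using v by (simp add: specht_swap_sum[OF v(1) a] scale)
  finally show ?thesis .
qed

lemma isotypic_swap_sum:
  assumes f: "f \<in> isotypic n k m (two_row (m - a) a)" and a: "2 * a \<le> m"
  shows "(\<Sum>p<m. \<Sum>q<m. word_act (transpose p q) f) = cscale (content_value m a) f"
  using f unfolding isotypic_def
proof (induction rule: cfun.span_induct_alt)
  case base
  show ?case by (simp add: fun_eq_iff sum_apply_fun word_act_def cscale_def)
next
  case (step c x y)
  then have x: "(\<Sum>p<m. \<Sum>q<m. word_act (transpose p q) x) = cscale (content_value m a) x"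
    using specht_iso_swap_sum a by blast
  show ?case
  proof
    fix T
    have "(\<Sum>p<m. \<Sum>q<m. word_act (transpose p q) x) T = cscale (content_value m a) x T"
      "(\<Sum>p<m. \<Sum>q<m. word_act (transpose p q) y) T = cscale (content_value m a) y T"
      using x step.IH by simp_all
    then show "(\<Sum>p<m. \<Sum>q<m. word_act (transpose p q) (cscale c x + y)) T =
          cscale (content_value m a) (cscale c x + y) T"
      by (simp add: sum_apply_fun word_act_def cscale_def sum.distrib algebra_simps
          flip: sum_distrib_left)
  qed
qed

text \<open>Exchanging two positions below \<open>n\<close> is an involution of
  \<open>words n k\<close>, by which the sum can be reindexed.\<close>

lemma word_inner_swap:
  assumes pq: "p < n" "q < n"
  shows "word_inner n k (word_act (transpose p q) f) g = word_inner n k f (word_act (transpose p q) g)"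
proof -
  let ?\<tau> = "permute_list (transpose p q) :: word \<Rightarrow> word"
  have perm: "transpose p q permutes {..<length w}" if "w \<in> words n k" for w
    using that pq by (auto simp: words_def intro: transpose_permutes_lessThan)
  have in_words: "?\<tau> w \<in> words n k" if "w \<in> words n k" for w
    using that perm[OF that] by (simp add: words_def flip: count_mset)
  have invol: "?\<tau> (?\<tau> w) = w" if "w \<in> words n k" for w
    using permute_list_compose[OF perm[OF that], of "transpose p q"] by simp
  have "bij_betw ?\<tau> (words n k) (words n k)"
    by (rule bij_betw_byWitness[where f' = ?\<tau>]) (use in_words invol in auto)
  then have "word_inner n k f (word_act (transpose p q) g) =
      (\<Sum>w\<in>words n k. f (?\<tau> w) * cnj (g (?\<tau> (?\<tau> w))))"
    unfolding word_inner_def word_act_def by (rule sum.reindex_bij_betw[symmetric])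
  also have "\<dots> = word_inner n k (word_act (transpose p q) f) g"
    by (simp add: word_inner_def word_act_def invol)
  finally show ?thesis by simp
qed

text \<open>Eigenvectors of a self-adjoint operator for distinct eigenvalues are orthogonal;
  \<open>m \<le> n\<close> keeps all exchanged positions inside the words.\<close>

lemma isotypic_orthogonal:
  assumes f: "f \<in> isotypic n k m (two_row (m - a) a)" and a: "2 * a \<le> m"
    and g: "g \<in> isotypic n k m (two_row (m - b) b)" and b: "2 * b \<le> m"
    and "a \<noteq> b" "m \<le> n"
  shows "word_inner n k f g = 0"
proof -
  have "content_value m a * word_inner n k f g =
      (\<Sum>p<m. \<Sum>q<m. word_inner n k (word_act (transpose p q) f) g)"
    by (simp flip: word_inner_scale_left isotypic_swap_sum[OF f a] add: word_inner_sum_left)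
  also have "\<dots> = (\<Sum>p<m. \<Sum>q<m. word_inner n k f (word_act (transpose p q) g))"
    using \<open>m \<le> n\<close> by (intro sum.cong refl word_inner_swap) auto
  also have "\<dots> = word_inner n k f (cscale (content_value m b) g)"
    by (simp flip: isotypic_swap_sum[OF g b] add: word_inner_sum_right)
  \<comment> \<open>The conjugation disappears because the eigenvalue is real.\<close>
  also have "\<dots> = content_value m b * word_inner n k f g"
    by (simp add: word_inner_scale_right content_value_def)
  finally show ?thesis
    using content_value_inj[OF _ a b] \<open>a \<noteq> b\<close> by auto
qed


section \<open>Chains ending in a two-row diagram\<close>

lemma card_two_row: "card (two_row p q) = p + q"
  unfolding two_row_def by (subst card_Un_disjoint) auto

lemma two_row_inject: "two_row p q = two_row p' q' \<longleftrightarrow> p = p' \<and> q = q'"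
proof
  assume eq: "two_row p q = two_row p' q'"
  have "c < p \<longleftrightarrow> c < p'" "c < q \<longleftrightarrow> c < q'" for c
    using eq two_row_iff[of 0 c p q] two_row_iff[of 0 c p' q']
      two_row_iff[of 1 c p q] two_row_iff[of 1 c p' q'] by auto
  then show "p = p' \<and> q = q'" by (metis linorder_neq_iff)
qed simp

lemma young_diagram_two_row:
  assumes "young_diagram (two_row p q)"
  shows "q \<le> p"
proof (rule ccontr)
  assume "\<not> q \<le> p"
  then have "(1, p) \<in> two_row p q" by (simp add: two_row_iff)
  then have "(0, p) \<in> two_row p q"
    using assms unfolding young_diagram_def by (meson le_refl zero_le)
  then show False by (simp add: two_row_iff)
qed

lemma two_row_young_diagram:
  assumes "q \<le> p"
  shows "young_diagram (two_row p q)"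
  using assms by (auto simp: young_diagram_def two_row_iff) (simp add: two_row_def)

lemma finite_downset_lessThan:
  fixes S :: "nat set"
  assumes fin: "finite S" and down: "\<And>x y. x \<in> S \<Longrightarrow> y \<le> x \<Longrightarrow> y \<in> S"
  shows "\<exists>p. S = {..<p}"
proof (cases "S = {}")
  case False
  have "S = {..<Suc (Max S)}"
    using down[OF Max_in[OF fin False]] Max_ge[OF fin] by (auto simp: less_Suc_eq_le)
  then show ?thesis ..
qed (use lessThan_0 in blast)

text \<open>Each row of a Young diagram is an initial segment, and the inclusion leaves only rows 0
  and 1. That the second row is no longer than the first gives
  \<open>2 * a \<le> card D\<close>.\<close>

lemma young_diagram_subset_two_row:
  assumes D: "young_diagram D" and sub: "D \<subseteq> two_row p q"
  shows "\<exists>a. D = two_row (card D - a) a \<and> 2 * a \<le> card D"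
proof -
  have down: "\<And>r c r' c'. (r, c) \<in> D \<Longrightarrow> r' \<le> r \<Longrightarrow> c' \<le> c \<Longrightarrow> (r', c') \<in> D"
    and fin: "finite D"
    using D by (auto simp: young_diagram_def)
  have "\<exists>p. {c. (r, c) \<in> D} = {..<p}" for r
  proof (rule finite_downset_lessThan)
    show "finite {c. (r, c) \<in> D}"
      by (rule finite_subset[OF _ finite_imageI[OF fin, of snd]]) force
  qed (use down in blast)
  then obtain p' where p': "\<And>r. {c. (r, c) \<in> D} = {..<p' r}" by metis
  have "D = two_row (p' 0) (p' 1)"
    using sub p' by (fastforce simp: two_row_def)
  then show ?thesis
    using D young_diagram_two_row[of "p' 0" "p' 1"]
    by (intro exI[of _ "p' 1"]) (auto simp: card_two_row)
qed

lemma diagram_chain_subset: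
  assumes ch: "diagram_chain ch" and "j \<le> j'" "j' < length ch"
  shows "ch ! j \<subseteq> ch ! j'"
  using assms(2,3)
proof (induction j' rule: dec_induct)
  case (step j')
  then have "adds_box (ch ! j') (ch ! Suc j')" using ch by (simp add: diagram_chain_def)
  then show ?case using step by (auto simp: adds_box_def)
qed simp

text \<open>All diagrams of a chain lie inside its last one. This makes the eigenvalues for two-row
  shapes available at every level, though \<open>labels\<close> restricts only the last
  diagram.\<close>

lemma diagram_chain_nth_two_row:
  assumes ch: "diagram_chain ch" and "last ch = two_row p q" and j: "j < length ch"
  shows "\<exists>a. ch ! j = two_row (Suc j - a) a \<and> 2 * a \<le> Suc j"
proof -
  have "ch ! j \<subseteq> two_row p q"
    using diagram_chain_subset[OF ch, of j "length ch - 1"] j assms(2)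
    by (cases ch rule: rev_cases) (auto simp: nth_append)
  moreover have "young_diagram (ch ! j)" "card (ch ! j) = Suc j"
    using ch j by (auto simp: diagram_chain_def)
  ultimately show ?thesis using young_diagram_subset_two_row by metis
qed

lemma labels_nth_two_row:
  assumes "(ch, c) \<in> labels n k i" "j < i"
  shows "\<exists>a. ch ! j = two_row (Suc j - a) a \<and> 2 * a \<le> Suc j"
proof -
  from assms obtain a where "diagram_chain ch" "last ch = two_row (i - a) a" "length ch = i"
    by (auto simp: labels_def)
  then show ?thesis using diagram_chain_nth_two_row assms(2) by blast
qed


section \<open>Orthonormality and sparsity\<close>

text \<open>A single level at which the chains disagree suffices. The chains may have different
  lengths, so that the lemma serves both within one family and between consecutive families.\<close>

lemma chain_space_orthogonal:
  assumes l: "(ch, c) \<in> labels n k i" "(ch', c') \<in> labels n k i'"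
    and j: "j < i" "j < i'" "i \<le> n" "ch ! j \<noteq> ch' ! j"
    and f: "f \<in> chain_space n k ch" and g: "g \<in> chain_space n k ch'"
  shows "word_inner n k f g = 0"
proof -
  obtain a where a: "ch ! j = two_row (Suc j - a) a" "2 * a \<le> Suc j"
    using labels_nth_two_row[OF l(1) j(1)] by blast
  obtain b where b: "ch' ! j = two_row (Suc j - b) b" "2 * b \<le> Suc j"
    using labels_nth_two_row[OF l(2) j(2)] by blast
  have "length ch = i" "length ch' = i'" using l by (auto simp: labels_def)
  then have "f \<in> isotypic n k (Suc j) (two_row (Suc j - a) a)"
    "g \<in> isotypic n k (Suc j) (two_row (Suc j - b) b)"
    using f g j a b by (auto simp: chain_space_def)
  then show ?thesis
    using isotypic_orthogonal a b j by (metis Suc_leI order_trans)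
qed

lemma suffix_space_nonzero:
  assumes f: "f \<in> suffix_space n k c" and "f w \<noteq> 0"
  shows "w \<in> words n k \<and> drop (n - length c) w = c"
proof (rule ccontr)
  assume *: "\<not> (w \<in> words n k \<and> drop (n - length c) w = c)"
  have "f w = 0"
    using f unfolding suffix_space_def
  proof (induction rule: cfun.span_induct_alt)
    case (step a x y)
    then show ?case using * by (auto simp: delta_def cscale_def split: if_splits)
  qed simp
  then show False using \<open>f w \<noteq> 0\<close> by simp
qed

text \<open>Incompatible suffixes give disjoint supports. The lengths may differ, again to cover
  consecutive families.\<close>

lemma suffix_space_orthogonal:
  assumes f: "f \<in> suffix_space n k c" and g: "g \<in> suffix_space n k c'"
    and len: "length c' \<le> length c" "length c \<le> n"
    and ne: "drop (length c - length c') c \<noteq> c'"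
  shows "word_inner n k f g = 0"
  unfolding word_inner_def
proof (intro sum.neutral ballI)
  fix w assume "w \<in> words n k"
  have "f w = 0 \<or> g w = 0"
  proof (rule ccontr)
    assume "\<not> (f w = 0 \<or> g w = 0)"
    then have "drop (n - length c) w = c" "drop (n - length c') w = c'"
      using suffix_space_nonzero f g by blast+
    moreover have "drop (length c - length c') (drop (n - length c) w) = drop (n - length c') w"
      using len by simp
    ultimately show False using ne by simp
  qed
  then show "f w * cnj (g w) = 0" by auto
qed

section \<open>The number of words\<close>

lemma words_eq_Cons:
  "words (Suc n) k = (#) 2 ` words n k \<union> (if k = 0 then {} else (#) 1 ` words n (k - 1))"
  by (auto simp: words_def length_Suc_conv image_iff split: if_splits)

lemma finite_words: "finite (words n k)"
  by (rule finite_subset[OF _ finite_lists_length_eq[of "{1, 2}" n]]) (auto simp: words_def)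

text \<open>Splitting by the first letter gives Pascal's rule.\<close>

lemma card_words: "card (words n k) = n choose k"
proof (induction n arbitrary: k)
  case 0
  have "words 0 k = (if k = 0 then {[]} else {})" by (auto simp: words_def)
  then show ?case by simp
next
  case (Suc n)
  show ?case
  proof (cases k)
    case 0
    then show ?thesis using Suc[of 0] by (simp add: words_eq_Cons card_image)
  next
    case (Suc k')
    have "(#) 2 ` words n k \<inter> (#) 1 ` words n k' = {}" by auto
    then show ?thesis
      using Suc.IH by (simp add: words_eq_Cons Suc card_Un_disjoint finite_words card_image)
  qed
qed


section \<open>Orthonormal families of functions on words: independence, spanning,
  coordinates\<close>

definition orthonormal_family :: "nat \<Rightarrow> nat \<Rightarrow> 'l set \<Rightarrow> ('l \<Rightarrow> word \<Rightarrow> complex) \<Rightarrow> bool" where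
  "orthonormal_family n k L b \<longleftrightarrow>
     (\<forall>l\<in>L. b l \<in> word_funs n k) \<and>
     (\<forall>l\<in>L. \<forall>l'\<in>L. word_inner n k (b l) (b l') = (if l = l' then 1 else 0))"

lemma orthonormal_family_inj_on: "orthonormal_family n k L b \<Longrightarrow> inj_on b L"
  unfolding orthonormal_family_def inj_on_def by (metis zero_neq_one)

lemma orthonormal_family_image_inner:
  assumes "orthonormal_family n k L b" "v \<in> b ` L" "v' \<in> b ` L"
  shows "word_inner n k v v' = (if v = v' then 1 else 0)"
  using assms orthonormal_family_inj_on[OF assms(1)]
  by (auto simp: orthonormal_family_def inj_on_eq_iff)

lemma orthonormal_family_independent:
  assumes b: "orthonormal_family n k L b"
  shows "cfun.independent (b ` L)"
proof
  assume "cfun.dependent (b ` L)"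
  then obtain t u v where t: "finite t" "t \<subseteq> b ` L" "(\<Sum>v\<in>t. cscale (u v) v) = 0"
    and v: "v \<in> t" "u v \<noteq> 0"
    unfolding cfun.dependent_explicit by blast
  have "0 = word_inner n k (\<Sum>v\<in>t. cscale (u v) v) v"
    by (simp add: t(3)) (simp add: word_inner_def)
  also have "\<dots> = (\<Sum>v'\<in>t. u v' * word_inner n k v' v)"
    by (simp add: word_inner_sum_left word_inner_scale_left)
  also have "\<dots> = (\<Sum>v'\<in>t. if v' = v then u v' else 0)"
    using t v orthonormal_family_image_inner[OF b] by (intro sum.cong) (auto simp: subset_iff)
  also have "\<dots> = u v" using t v by simp
  finally show False using v by simp
qed

lemma word_funs_subset_span: "word_funs n k \<subseteq> cfun.span (delta ` words n k)"
proof
  fix f assume f: "f \<in> word_funs n k"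
  have "f = (\<Sum>w\<in>words n k. cscale (f w) (delta w))"
  proof
    fix x
    have "(\<Sum>w\<in>words n k. cscale (f w) (delta w)) x = (\<Sum>w\<in>words n k. if x = w then f w else 0)"
      by (auto simp: sum_apply_fun cscale_def delta_def intro!: sum.cong)
    then show "f x = (\<Sum>w\<in>words n k. cscale (f w) (delta w)) x"
      using f by (simp add: finite_words word_funs_def)
  qed
  then show "f \<in> cfun.span (delta ` words n k)"
    by (metis (no_types, lifting) cfun.span_base cfun.span_scale cfun.span_sum imageI)
qed

lemma independent_word_funs_bound:
  assumes "cfun.independent S" "S \<subseteq> word_funs n k"
  shows "finite S \<and> card S \<le> n choose k"
proof -
  have "finite S \<and> card S \<le> card (delta ` words n k :: (word \<Rightarrow> complex) set)"
    using assms word_funs_subset_span by (intro cfun.independent_span_bound) (auto simp: finite_words)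
  moreover have "card (delta ` words n k :: (word \<Rightarrow> complex) set) \<le> n choose k"
    using card_image_le[OF finite_words] by (metis card_words)
  ultimately show ?thesis by auto
qed

lemma orthonormal_family_card_le:
  assumes b: "orthonormal_family n k L b"
  shows "finite L \<and> card L \<le> n choose k"
proof -
  have "finite (b ` L) \<and> card (b ` L) \<le> n choose k"
    using b by (intro independent_word_funs_bound orthonormal_family_independent)
      (auto simp: orthonormal_family_def)
  then show ?thesis
    using orthonormal_family_inj_on[OF b] by (simp add: card_image finite_image_iff)
qed

text \<open>A function outside the span could be added to the family, giving an independent set with
  more than \<open>n choose k\<close> members.\<close>

lemma orthonormal_family_span:
  assumes b: "orthonormal_family n k L b" and card: "n choose k \<le> card L"
    and f: "f \<in> word_funs n k"
  shows "f \<in> cfun.span (b ` L)"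
proof (rule ccontr)
  assume nspan: "f \<notin> cfun.span (b ` L)"
  have "insert f (b ` L) \<subseteq> word_funs n k"
    using b f by (auto simp: orthonormal_family_def)
  then have "finite (insert f (b ` L)) \<and> card (insert f (b ` L)) \<le> n choose k"
    by (rule independent_word_funs_bound
        [OF cfun.independent_insertI[OF nspan orthonormal_family_independent[OF b]]])
  moreover have "f \<notin> b ` L" using nspan cfun.span_base by blast
  ultimately show False
    using card card_image[OF orthonormal_family_inj_on[OF b]] by (auto simp: card_insert_disjoint)
qed

lemma orthonormal_family_coords:
  assumes b: "orthonormal_family n k L b" and card: "n choose k \<le> card L"
    and f: "f \<in> word_funs n k" and l: "l \<in> L"
  shows "coords L b f l = word_inner n k f (b l)"
proof -
  let ?rep = "cfun.representation (b ` L) f"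
  have fin: "finite (b ` L)" using orthonormal_family_card_le[OF b] by simp
  have "f = (\<Sum>v\<in>b ` L. cscale (?rep v) v)"
    using cfun.sum_representation_eq[OF orthonormal_family_independent[OF b]
        orthonormal_family_span[OF b card f] fin] by simp
  then have "word_inner n k f (b l) = (\<Sum>v\<in>b ` L. ?rep v * word_inner n k v (b l))"
    by (metis (no_types, lifting) sum.cong word_inner_scale_left word_inner_sum_left)
  also have "\<dots> = (\<Sum>v\<in>b ` L. if v = b l then ?rep v else 0)"
    using l orthonormal_family_image_inner[OF b] by (intro sum.cong) auto
  also have "\<dots> = ?rep (b l)" using fin l by simp
  finally show ?thesis by (simp add: coords_def)
qed

text \<open>Parseval's identity. With \<open>g\<close> taken from another orthonormal basis it
  becomes the matrix-vector product for a change of basis.\<close>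

lemma orthonormal_family_expansion:
  assumes b: "orthonormal_family n k L b" and card: "n choose k \<le> card L"
    and f: "f \<in> word_funs n k"
  shows "word_inner n k f g = (\<Sum>l\<in>L. word_inner n k f (b l) * word_inner n k (b l) g)"
proof -
  let ?rep = "cfun.representation (b ` L) f"
  have fin: "finite (b ` L)" using orthonormal_family_card_le[OF b] by simp
  have "f = (\<Sum>v\<in>b ` L. cscale (?rep v) v)"
    using cfun.sum_representation_eq[OF orthonormal_family_independent[OF b]
        orthonormal_family_span[OF b card f] fin] by simp
  then have "word_inner n k f g = (\<Sum>v\<in>b ` L. ?rep v * word_inner n k v g)"
    by (metis (no_types, lifting) sum.cong word_inner_scale_left word_inner_sum_left)
  also have "\<dots> = (\<Sum>l\<in>L. ?rep (b l) * word_inner n k (b l) g)"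
    by (simp add: sum.reindex[OF orthonormal_family_inj_on[OF b]])
  also have "\<dots> = (\<Sum>l\<in>L. word_inner n k f (b l) * word_inner n k (b l) g)"
    using orthonormal_family_coords[OF assms] by (intro sum.cong) (auto simp: coords_def)
  finally show ?thesis .
qed

section \<open>Intermediate families: orthonormality and sparsity of consecutive ones\<close>

lemma labels_length:
  assumes "(ch, c) \<in> labels n k i"
  shows "length ch = i" "length c = n - i"
  using assms by (auto simp: labels_def)

text \<open>Labels with different suffixes have disjoint supports; labels with equal suffixes have
  chains that disagree at some level, where isotypic components are orthogonal.\<close>

lemma intermediate_basis_orthonormal:
  assumes B: "intermediate_basis n k i b" and "i \<le> n"
  shows "orthonormal_family n k (labels n k i) b"
  unfolding orthonormal_family_def
proof (intro conjI ballI)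
  fix l assume l: "l \<in> labels n k i"
  obtain ch c where l_eq: "l = (ch, c)" by (cases l)
  have bl: "b l \<in> chain_space n k ch" "b l \<in> suffix_space n k c" "word_inner n k (b l) (b l) = 1"
    using B l by (auto simp: intermediate_basis_def l_eq)
  then show "b l \<in> word_funs n k" by (simp add: chain_space_def)
  fix l' assume l': "l' \<in> labels n k i"
  obtain ch' c' where l'_eq: "l' = (ch', c')" by (cases l')
  have bl': "b l' \<in> chain_space n k ch'" "b l' \<in> suffix_space n k c'"
    using B l' by (auto simp: intermediate_basis_def l'_eq)
  note len = labels_length[OF l[unfolded l_eq]] labels_length[OF l'[unfolded l'_eq]]
  show "word_inner n k (b l) (b l') = (if l = l' then 1 else 0)"
  proof (cases "c = c'")
    case False
    then show ?thesis
      using suffix_space_orthogonal[OF bl(2) bl'(2)] len by (auto simp: l_eq l'_eq)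
  next
    case True
    show ?thesis
    proof (cases "ch = ch'")
      case False
      then obtain j where "j < i" "ch ! j \<noteq> ch' ! j" using len by (metis nth_equalityI)
      then show ?thesis
        using chain_space_orthogonal[OF l[unfolded l_eq] l'[unfolded l'_eq]] bl bl' \<open>i \<le> n\<close> False
        by (auto simp: l_eq l'_eq)
    qed (use True bl in \<open>simp add: l_eq l'_eq\<close>)
  qed
qed

text \<open>Outside the two exceptional labels either \<open>c\<close> is not \<open>c'\<close> with
  one letter in front, or \<open>ch\<close> disagrees with \<open>ch'\<close> at one of the first
  \<open>i\<close> levels.\<close>

lemma intermediate_basis_sparse:
  assumes B: "intermediate_basis n k i b" and B': "intermediate_basis n k (Suc i) b'"
    and i: "Suc i \<le> n"
    and l: "(ch, c) \<in> labels n k i" and l': "(ch', c') \<in> labels n k (Suc i)"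
    and ne: "(ch, c) \<notin> {(butlast ch', 1 # c'), (butlast ch', 2 # c')}"
  shows "word_inner n k (b (ch, c)) (b' (ch', c')) = 0"
proof -
  have bl: "b (ch, c) \<in> chain_space n k ch" "b (ch, c) \<in> suffix_space n k c"
    using B l by (auto simp: intermediate_basis_def)
  have bl': "b' (ch', c') \<in> chain_space n k ch'" "b' (ch', c') \<in> suffix_space n k c'"
    using B' l' by (auto simp: intermediate_basis_def)
  note len = labels_length[OF l] labels_length[OF l']
  show ?thesis
  proof (cases "drop 1 c = c'")
    case False
    then show ?thesis
      using suffix_space_orthogonal[OF bl(2) bl'(2)] len i by auto
  next
    case True
    then obtain x where x: "c = x # c'" using len i by (cases c) auto
    moreover have "x \<in> {1, 2}" using l x by (auto simp: labels_def)
    ultimately have "ch \<noteq> butlast ch'" using ne by auto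
    then obtain j where "j < i" "ch ! j \<noteq> butlast ch' ! j"
      using len by (metis diff_Suc_1 length_butlast nth_equalityI)
    moreover from this have "butlast ch' ! j = ch' ! j" using len by (simp add: nth_butlast)
    ultimately show ?thesis
      using chain_space_orthogonal[OF l l', of j] bl bl' i by auto
  qed
qed


section \<open>Counting labels\<close>

text \<open>Recovers \<open>a\<close> from \<open>two_row (i - a) a\<close>. On the empty diagram it
  is 0, the starting value for an empty chain.\<close>

definition second_row :: "diagram \<Rightarrow> nat" where
  "second_row D = card {c. (1, c) \<in> D}"

lemma second_row_two_row: "second_row (two_row p q) = q"
  by (simp add: second_row_def two_row_iff)

text \<open>
  Injects the labels of level \<open>i\<close> into those of level \<open>Suc i\<close>: the letter removed from the suffix
  decides which row receives the new box.  The roles of the two letters depend on which of \<open>r\<close> and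
  \<open>Suc i - r\<close> bounds the second row of the new diagram, where \<open>r\<close> counts the letters 1 outside the new suffix.
\<close>

definition extend_label :: "nat \<Rightarrow> label \<Rightarrow> label" where
  "extend_label k = (\<lambda>(ch, w).
     let i = length ch; b = second_row (last ({} # ch)) in
       (ch @ [if (hd w = 2) = (2 * (k - count_list (tl w) 1) < Suc i)
              then two_row (Suc i - b) b else two_row (i - b) (Suc b)], tl w))"

lemma diagram_chain_snoc:
  "diagram_chain (ch @ [D]) \<longleftrightarrow>
     diagram_chain ch \<and> young_diagram D \<and> card D = Suc (length ch) \<and>
     (ch \<noteq> [] \<longrightarrow> adds_box (last ch) D)"
proof -
  have "(\<forall>j. Suc j < length (ch @ [D]) \<longrightarrow> adds_box ((ch @ [D]) ! j) ((ch @ [D]) ! Suc j)) \<longleftrightarrow>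
     (\<forall>j. Suc j < length ch \<longrightarrow> adds_box (ch ! j) (ch ! Suc j)) \<and> (ch \<noteq> [] \<longrightarrow> adds_box (last ch) D)"
    by (cases ch rule: rev_cases) (auto simp: nth_append less_Suc_eq)
  moreover have "(\<forall>j < length (ch @ [D]). young_diagram ((ch @ [D]) ! j) \<and> card ((ch @ [D]) ! j) = Suc j) \<longleftrightarrow>
     (\<forall>j < length ch. young_diagram (ch ! j) \<and> card (ch ! j) = Suc j) \<and>
     young_diagram D \<and> card D = Suc (length ch)"
    by (auto simp: nth_append less_Suc_eq)
  ultimately show ?thesis unfolding diagram_chain_def by blast
qed

lemma adds_box_two_row:
  "adds_box (two_row p q) (two_row (Suc p) q)" "adds_box (two_row p q) (two_row p (Suc q))"
proof -
  have "two_row (Suc p) q = insert (0, p) (two_row p q)"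
    "two_row p (Suc q) = insert (1, q) (two_row p q)"
    by (auto simp: two_row_def)
  moreover have "(0, p) \<notin> two_row p q" "(1, q) \<notin> two_row p q"
    by (auto simp: two_row_iff)
  ultimately show "adds_box (two_row p q) (two_row (Suc p) q)"
    "adds_box (two_row p q) (two_row p (Suc q))"
    unfolding adds_box_def by blast+
qed

lemma labelsE:
  assumes "(ch, w) \<in> labels n k i" "i < n"
  obtains x c a r where "w = x # c" "x \<in> {1, 2}" "set c \<subseteq> {1, 2}" "length c = n - Suc i"
    "length ch = i" "diagram_chain ch" "last ({} # ch) = two_row (i - a) a"
    "r \<le> k" "count_list w 1 = k - r" "a \<le> r" "a + r \<le> i"
proof -
  obtain a r where ar: "r \<le> k" "count_list w 1 = k - r" "a \<le> r" "a + r \<le> i"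
    "i > 0 \<longrightarrow> last ch = two_row (i - a) a"
    using assms by (auto simp: labels_def)
  obtain x c where w: "w = x # c"
    using labels_length[OF assms(1)] assms(2) by (cases w) auto
  \<comment> \<open>The empty diagram put in front is \<open>two_row 0 0\<close>, so level 0 needs
    no separate treatment later.\<close>
  have last: "last ({} # ch) = two_row (i - a) a"
  proof (cases "ch = []")
    case True
    then have "i = 0" "a = 0" using ar(4) labels_length[OF assms(1)] by auto
    then show ?thesis by (simp add: True two_row_def)
  qed (use ar(5) labels_length[OF assms(1)] in auto)
  have "x \<in> {1, 2}" "set c \<subseteq> {1, 2}" "diagram_chain ch"
    using assms(1) by (auto simp: labels_def w)
  moreover have "length c = n - Suc i" "length ch = i"
    using labels_length[OF assms(1)] by (auto simp: w)
  ultimately show ?thesis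
    using that w last ar by blast
qed

text \<open>The second row is bounded by both \<open>r\<close> and \<open>i - r\<close>. Moving a
  letter 1 out of the suffix raises the first bound by one, a letter 2 the second. The box goes to
  the second row exactly when the bound that is smaller at level \<open>Suc i\<close> is the one
  just raised; on a tie \<open>Suc i - r'\<close> counts as the smaller.\<close>

lemma extend_label_in_labels:
  assumes "(ch, w) \<in> labels n k i" "i < n"
  shows "extend_label k (ch, w) \<in> labels n k (Suc i)"
  using assms
proof (cases rule: labelsE)
  case (1 x c a r)
  define r' where "r' = k - count_list c 1"
  have r': "r' \<le> k" "count_list c 1 = k - r'" "r' = (if x = 1 then Suc r else r)"
    using 1 by (auto simp: r'_def split: if_splits)
  define row0 where "row0 \<longleftrightarrow> (x = 2) = (2 * r' < Suc i)"
  define D where "D = (if row0 then two_row (Suc i - a) a else two_row (i - a) (Suc a))"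
  define a' where "a' = (if row0 then a else Suc a)"
  have D: "D = two_row (Suc i - a') a'" by (simp add: D_def a'_def)
  have a': "a' \<le> r'" "a' + r' \<le> Suc i"
    using 1 r' by (auto simp: a'_def row0_def split: if_splits)
  then have "2 * a' \<le> Suc i" by simp
  moreover have "adds_box (two_row (i - a) a) D"
    using adds_box_two_row[of "i - a" a] 1 by (auto simp: D_def Suc_diff_le)
  ultimately have "diagram_chain (ch @ [D])"
    using 1 by (auto simp: diagram_chain_snoc D card_two_row intro!: two_row_young_diagram)
  moreover have "extend_label k (ch, w) = (ch @ [D], c)"
    using 1 by (auto simp: extend_label_def Let_def second_row_two_row D_def row0_def r'_def)
  ultimately show ?thesis
    using 1 r' a' D by (auto simp: labels_def)
qed

text \<open>The old chain and the tail of the suffix survive in the image. For a fixed chain the two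
  possible new diagrams differ, so the new diagram reveals the removed letter.\<close>

lemma inj_on_extend_label:
  assumes "i < n"
  shows "inj_on (extend_label k) (labels n k i)"
proof (rule inj_onI)
  fix l l' assume l: "l \<in> labels n k i" and l': "l' \<in> labels n k i"
    and eq: "extend_label k l = extend_label k l'"
  obtain ch w ch' w' where l_eq: "l = (ch, w)" "l' = (ch', w')" by (cases l, cases l')
  have same: "ch = ch'" "tl w = tl w'"
    using eq by (auto simp: l_eq extend_label_def Let_def)
  have "(hd w = 2) = (hd w' = 2)"
    using eq by (auto simp: l_eq extend_label_def Let_def same two_row_inject split: if_splits)
  moreover obtain x c where "w = x # c" "x \<in> {1, 2}"
    using labelsE[OF l[unfolded l_eq] assms] by metis
  moreover obtain x' c' where "w' = x' # c'" "x' \<in> {1, 2}"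
    using labelsE[OF l'[unfolded l_eq] assms] by metis
  ultimately show "l = l'" using same by (auto simp: l_eq)
qed

text \<open>At level 0 the inequality \<open>a + r \<le> i\<close> forces \<open>r = 0\<close>, so
  the suffix is a whole word with \<open>k\<close> letters 1.\<close>

lemma labels_0: "labels n k 0 = Pair [] ` words n k"
  by (auto simp: labels_def words_def diagram_chain_def image_iff)

text \<open>The count starts with the words at level 0 and cannot drop along the injections.
  Finiteness, required to compare cardinalities, is supplied in the theorem by
  orthonormality.\<close>

lemma binomial_le_card_labels:
  assumes "\<And>j. j \<le> i \<Longrightarrow> finite (labels n k j)" "i \<le> n"
  shows "n choose k \<le> card (labels n k i)"
  using assms
proof (induction i)
  case 0
  show ?case by (simp add: labels_0 card_image inj_on_def card_words)
next
  case (Suc i)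
  have "card (labels n k i) \<le> card (labels n k (Suc i))"
    using Suc.prems inj_on_extend_label[of i n k] extend_label_in_labels[of _ _ n k i]
    by (intro card_inj_on_le[of "extend_label k"]) auto
  then show ?case using Suc by force
qed


section \<open>Straight-line programs\<close>

lemma run_append: "run e (P @ Q) regs = run e Q (run e P regs)"
  by (induction e P regs rule: run.induct) auto

lemma length_run [simp]: "length (run e P regs) = length regs + length P"
  by (induction e P regs rule: run.induct) auto

text \<open>A register past the end reads as 0 and would change its value when the program grows;
  this predicate excludes such operands.\<close>

fun operand_below :: "nat \<Rightarrow> 'v operand \<Rightarrow> bool" where
  "operand_below N (Reg j) = (j < N)"
| "operand_below N _ = True"

lemma operand_below_mono: "operand_below N x \<Longrightarrow> N \<le> M \<Longrightarrow> operand_below M x"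
  by (cases x) auto

lemma operand_value_append:
  "operand_below (length regs) x \<Longrightarrow> operand_value e (regs @ ys) x = operand_value e regs x"
  by (cases x) (auto simp: nth_append)

lemma operand_value_run_append:
  assumes "operand_below (length P) x"
  shows "operand_value e (run e (P @ Q) []) x = operand_value e (run e P []) x"
proof -
  have "\<exists>ys. run e Q regs = regs @ ys" for regs
    by (induction e Q regs rule: run.induct) force+
  then obtain ys where "run e (P @ Q) [] = run e P [] @ ys"
    by (metis run_append)
  then show ?thesis using assms by (simp add: operand_value_append)
qed

text \<open>Program and outputs are chosen before \<open>f\<close>, so one program serves all of
  \<open>F\<close>. The outputs stay within existing registers so that the program can be
  extended.\<close>

definition computable ::
  "nat \<Rightarrow> 'f set \<Rightarrow> ('f \<Rightarrow> 'v \<Rightarrow> complex) \<Rightarrow> ('f \<Rightarrow> 'l \<Rightarrow> complex) \<Rightarrow> bool" where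
  "computable N F env val \<longleftrightarrow>
     (\<exists>P out. length P \<le> N \<and> (\<forall>l. operand_below (length P) (out l)) \<and>
        (\<forall>f\<in>F. \<forall>l. program_output (env f) P out l = val f l))"

text \<open>Two instructions per index of \<open>M\<close>, appended one index at a time.
  \<open>P\<close> remains a prefix throughout, so its outputs stay readable as operands.\<close>

lemma computable_two_term_sums:
  fixes env :: "'f \<Rightarrow> 'v \<Rightarrow> complex"
  assumes c: "computable N F env val" and "finite M"
  shows "computable (N + 2 * card M) F env (\<lambda>f m. if m \<in> M then
           env f (x1 m) * val f (l1 m) + env f (x2 m) * val f (l2 m) else 0)"
proof -
  let ?val' = "\<lambda>M f m. if m \<in> M then env f (x1 m) * val f (l1 m) + env f (x2 m) * val f (l2 m) else 0"
  obtain P out where P: "length P \<le> N" "\<And>l. operand_below (length P) (out l)"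
    "\<And>f l. f \<in> F \<Longrightarrow> operand_value (env f) (run (env f) P []) (out l) = val f l"
    using c unfolding computable_def program_output_def by blast
  have "\<exists>Q out'. length Q = 2 * card M \<and> (\<forall>m. operand_below (length (P @ Q)) (out' m)) \<and>
     (\<forall>f\<in>F. \<forall>m. operand_value (env f) (run (env f) (P @ Q) []) (out' m) = ?val' M f m)"
    using \<open>finite M\<close>
  proof (induction M rule: finite_induct)
    case empty
    show ?case by (intro exI[of _ "[]"] exI[of _ "\<lambda>_. Const0"]) auto
  next
    case (insert m M)
    then obtain Q out' where Q: "length Q = 2 * card M"
      "\<And>m. operand_below (length (P @ Q)) (out' m)"
      "\<And>f m. f \<in> F \<Longrightarrow> operand_value (env f) (run (env f) (P @ Q) []) (out' m) = ?val' M f m"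
      by blast
    \<comment> \<open>The first product is added to the constant 0 and lands in register
      \<open>length (P @ Q)\<close>; the second instruction adds the other product to it and writes
      the next register.\<close>
    define R :: "'v program" where "R = [(Const0, Input (x1 m), out (l1 m)),
       (Reg (length (P @ Q)), Input (x2 m), out (l2 m))]"
    define out'' where "out'' = out'(m := Reg (Suc (length (P @ Q))))"
    have "operand_value (env f) (run (env f) (P @ Q @ R) []) (out'' m') = ?val' (insert m M) f m'"
      if f: "f \<in> F" for f m'
    proof (cases "m' = m")
      case False
      then show ?thesis
        using operand_value_run_append[OF Q(2), of "env f" R m'] Q(3)[OF f] by (simp add: out''_def)
    next
      case True
      let ?regs = "run (env f) (P @ Q) []"
      have v: "operand_value (env f) ?regs (out l) = val f l" for l
        using operand_value_run_append[OF P(2)] P(3)[OF f] by simp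
      have v': "operand_value (env f) (?regs @ ys) (out l) = val f l" for l ys
        using operand_value_append[of ?regs "out l"] operand_below_mono[OF P(2)] v by simp
      have "run (env f) (P @ Q @ R) [] = run (env f) R ?regs"
        by (simp add: run_append)
      then show ?thesis
        using True by (simp add: R_def v v' out''_def nth_append)
    qed
    moreover have "operand_below (length (P @ Q @ R)) (out'' m')" for m'
      using operand_below_mono[OF Q(2)] by (auto simp: out''_def R_def)
    moreover have "length (Q @ R) = 2 * card (insert m M)"
      using insert.hyps Q(1) by (simp add: R_def)
    ultimately show ?case by (intro exI[of _ "Q @ R"] exI[of _ out'']) auto
  qed
  then obtain Q out' where "length Q = 2 * card M" "\<And>m. operand_below (length (P @ Q)) (out' m)"
    "\<And>f m. f \<in> F \<Longrightarrow> operand_value (env f) (run (env f) (P @ Q) []) (out' m) = ?val' M f m"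
    by blast
  then show ?thesis
    using P(1) unfolding computable_def program_output_def
    by (intro exI[of _ "P @ Q"] exI[of _ out']) simp
qed

lemma computable_cong:
  assumes "computable N F env val" "N \<le> N'" "\<And>f l. f \<in> F \<Longrightarrow> val f l = val' f l"
  shows "computable N' F env val'"
  using assms unfolding computable_def by (metis order_trans)


section \<open>The algorithm\<close>

theorem theorem5:
  fixes n k :: nat
    and B :: "nat \<Rightarrow> label \<Rightarrow> word \<Rightarrow> complex"
  assumes "1 \<le> n" and "k \<le> n"
    and "\<And>i. i \<le> n \<Longrightarrow> intermediate_basis n k i (B i)"
    and "B 1 ` labels n k 1 = B 0 ` labels n k 0"
  shows "(\<forall>f\<in>word_funs n k. \<forall>l\<in>labels n k n.
            coords (labels n k n) (B n) f l =
              (\<Sum>l'\<in>labels n k 0.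
                 change_matrix (labels n k n) (B n) (B 0) l l' * coords (labels n k 0) (B 0) f l'))
       \<and> (\<exists>(P :: input program) (out :: label \<Rightarrow> input operand).
            length P \<le> 2 * (n - 1) * (n choose k) \<and>
            (\<forall>f\<in>word_funs n k. \<forall>l\<in>labels n k n.
               program_output (input_env n k B f) P out l = coords (labels n k n) (B n) f l))"
proof -
  let ?L = "labels n k"
  \<comment> \<open>The value is 0 off the labels because the two neighbours \<open>?l1 l\<close>
    and \<open>?l2 l\<close> of a label need not both be labels of the previous level.\<close>
  let ?val = "\<lambda>i f l. if l \<in> ?L i then coords (?L i) (B i) f l else 0"
  let ?l1 = "\<lambda>l. (butlast (fst l), 1 # snd l)" and ?l2 = "\<lambda>l. (butlast (fst l), 2 # snd l)"
  let ?M = "\<lambda>i f l l'. input_env n k B f (Entry (Suc i) l l')"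
  let ?two = "\<lambda>i f l. if l \<in> ?L (Suc i) then
      ?M i f l (?l1 l) * ?val i f (?l1 l) + ?M i f l (?l2 l) * ?val i f (?l2 l) else 0"
  have on: "orthonormal_family n k (?L i) (B i)" if "i \<le> n" for i
    using intermediate_basis_orthonormal assms(3) that by blast
  have fin: "finite (?L i)" and card_le: "card (?L i) \<le> n choose k" if "i \<le> n" for i
    using orthonormal_family_card_le[OF on[OF that]] by auto
  have card_ge: "n choose k \<le> card (?L i)" if "i \<le> n" for i
    using that fin by (intro binomial_le_card_labels) auto
  have in_funs: "B i l \<in> word_funs n k" if "i \<le> n" "l \<in> ?L i" for i l
    using on[OF that(1)] that(2) by (simp add: orthonormal_family_def)
  have coords: "coords (?L i) (B i) f l = word_inner n k f (B i l)"
    if "i \<le> n" "f \<in> word_funs n k" "l \<in> ?L i" for i f l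
    using orthonormal_family_coords[OF on card_ge] that by simp
  have change: "coords (?L j) (B j) f l =
      (\<Sum>l'\<in>?L i. change_matrix (?L j) (B j) (B i) l l' * coords (?L i) (B i) f l')"
    if "i \<le> n" "j \<le> n" "f \<in> word_funs n k" "l \<in> ?L j" for i j f l
    using orthonormal_family_expansion[OF on card_ge, of i f "B j l"] that
    by (simp add: coords change_matrix_def in_funs mult.commute)
  have step: "?val (Suc i) f l = ?two i f l"
    if i: "1 \<le> i" "Suc i \<le> n" and f: "f \<in> word_funs n k" for i f l
  proof (cases "l \<in> ?L (Suc i)")
    case True
    let ?g = "\<lambda>l'. ?M i f l l' * ?val i f l'"
    have "coords (?L (Suc i)) (B (Suc i)) f l =
        (\<Sum>l'\<in>?L i. change_matrix (?L (Suc i)) (B (Suc i)) (B i) l l' * coords (?L i) (B i) f l')"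
      using i f True by (intro change) auto
    also have "\<dots> = (\<Sum>l'\<in>?L i. ?g l')"
      using i True by (intro sum.cong) (auto simp: input_env_def)
    \<comment> \<open>Labels other than the two neighbours drop out by sparsity; a neighbour that is
      no label contributes 0 through the default in \<open>?val\<close>.\<close>
    also have "\<dots> = (\<Sum>l'\<in>{?l1 l, ?l2 l}. ?g l')"
    proof (rule sum.mono_neutral_cong)
      fix l' assume l': "l' \<in> ?L i - {?l1 l, ?l2 l}"
      have "word_inner n k (B i l') (B (Suc i) l) = 0"
        using intermediate_basis_sparse[of n k i "B i" "B (Suc i)" "fst l'" "snd l'" "fst l" "snd l"]
          assms(3) i l' True by auto
      then have "change_matrix (?L (Suc i)) (B (Suc i)) (B i) l l' = 0"
        using i l' True by (simp add: change_matrix_def coords in_funs)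
      then show "?g l' = 0" by (simp add: input_env_def)
    qed (use fin i in auto)
    finally show ?thesis using True by simp
  qed simp
  \<comment> \<open>Indexed by \<open>Suc i\<close> so that the induction starts at level 1 with the
    empty program; each later level adds \<open>2 * (n choose k)\<close>.\<close>
  have comp: "computable (2 * (Suc i - 1) * (n choose k)) (word_funs n k) (input_env n k B) (?val (Suc i))"
    if "Suc i \<le> n" for i
    using that
  proof (induction i)
    case 0
    \<comment> \<open>The families at levels 0 and 1 have the same members, so the coordinates at
      level 1 are input coordinates read under the matching label \<open>h l\<close>.\<close>
    have "\<exists>l'\<in>?L 0. B 0 l' = B 1 l" if "l \<in> ?L 1" for l
      using that assms(4) by (metis image_iff)
    then obtain h where h: "\<And>l. l \<in> ?L 1 \<Longrightarrow> h l \<in> ?L 0 \<and> B 0 (h l) = B 1 l" by metis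
    let ?out = "\<lambda>l. if l \<in> ?L 1 then Input (Coord (h l)) else Const0"
    have "program_output (input_env n k B f) [] ?out l = ?val 1 f l" for f l
      using h[of l] assms(4) by (simp add: program_output_def input_env_def coords_def)
    then show ?case
      unfolding computable_def by (intro exI[of _ "[]"] exI[of _ ?out]) auto
  next
    case (Suc i)
    have "computable (2 * (Suc i - 1) * (n choose k) + 2 * card (?L (Suc (Suc i)))) (word_funs n k)
       (input_env n k B) (?two (Suc i))"
      using Suc fin by (intro computable_two_term_sums) auto
    then show ?case
    proof (rule computable_cong)
      \<comment> \<open>The number of matrix rows is the number of labels, at most
        \<open>n choose k\<close> by linear independence.\<close>
      show "2 * (Suc i - 1) * (n choose k) + 2 * card (?L (Suc (Suc i)))
          \<le> 2 * (Suc (Suc i) - 1) * (n choose k)"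
        using card_le[OF Suc.prems] by (simp add: algebra_simps)
    qed (use step Suc.prems in auto)
  qed
  have n: "Suc (n - 1) = n" using assms(1) by simp
  have "computable (2 * (n - 1) * (n choose k)) (word_funs n k) (input_env n k B) (?val n)"
    using comp[of "n - 1", unfolded n] by simp
  then obtain P out where P: "length P \<le> 2 * (n - 1) * (n choose k)"
    "\<And>f l. f \<in> word_funs n k \<Longrightarrow> program_output (input_env n k B f) P out l = ?val n f l"
    unfolding computable_def by blast
  show ?thesis
  proof (intro conjI exI[of _ P] exI[of _ out] ballI)
    show "length P \<le> 2 * (n - 1) * (n choose k)" by (rule P(1))
  \<comment> \<open>The matrix identity is the expansion taken directly between levels 0 and
    \<open>n\<close>.\<close>
  qed (simp_all add: change[of 0 n] P(2))
qed

end
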